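(* Let $n$ be a positive integer and let $\mathbb{F}$ be a field with $\operatorname{char}(\mathbb{F})\neq 2$ and $|\mathbb{F}|\geq n^2+1$. Let $\Sigma_n$ denote the set of all $n\times n$ symmetric matrices over $\mathbb{F}$ and $M_n$ the set of all $n\times n$ matrices over $\mathbb{F}$. Let $\phi,\psi:\Sigma_n\to\Sigma_n$ be maps, at least one of which is surjective, satisfying $$\det(\phi(x)+\psi(y))=\det(x+y)\qquad\text{for all } x,y\in\Sigma_n.$$ Then there exist $x_0\in\Sigma_n$, $u\in M_n$ and $\beta\in\mathbb{F}$ with $\det(\beta u^2)=1$ such that $$\phi(x)=\beta u(x+x_0)u^t\quad\text{and}\quad \psi(x)=\beta u(x-x_0)u^t\qquad\text{for all } x\in\Sigma_n.$$
   Context: $u^t$ denotes the transpose of $u$, and $\beta u^2$ is the scalar $\beta$ times the matrix $u^2=uu$. *)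

theory Defs
  imports "HOL-Analysis.Analysis"
begin

definition sym_mats :: "('a::comm_ring_1^'n^'n) set" where
  "sym_mats = {A. transpose A = A}"

definition msmult :: "'a::comm_ring_1 \<Rightarrow> 'a^'n^'n \<Rightarrow> 'a^'n^'n" where
  "msmult c A = (\<chi> i j. c * A $ i $ j)"

end

theory Submission
  imports Defs
begin

text \<open>Say \<open>\<psi>\<close> is surjective (otherwise swap the maps). A symmetric matrix \<open>M\<close> is determined by the
  function \<open>A \<mapsto> det (A + M)\<close> on symmetric matrices, since differencing in \<open>A\<close> extracts principal minors.
  By the same argument, because \<open>det (B + t v v\<^sup>t)\<close> is affine in \<open>t\<close>, the entries of
  \<open>\<phi> (x + t v v\<^sup>t)\<close> and their relevant \<open>2 \<times> 2\<close> minors are affine in \<open>t\<close>: so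
  \<open>\<phi> (x + t v v\<^sup>t) = \<phi> x + t C\<close> with \<open>C\<close> of rank one. As a line of matrices of rank exactly one that
  is defined for all scalars is constant, \<open>C\<close> does not depend on \<open>x\<close>, and \<open>\<phi> - \<phi> 0\<close> is linear. It
  preserves determinants and maps squares \<open>v v\<^sup>t\<close> to matrices of rank at most one. After a congruence it
  scales each \<open>E\<^sub>i\<^sub>i\<close>, hence multiplies by a fixed matrix \<open>m\<close> entrywise; \<open>m\<close> is the image of the
  all-ones matrix, so it has rank one too. Finally \<open>\<psi>\<close> is recovered from \<open>\<phi>\<close> by the first remark.\<close>

section \<open>Symmetric matrices and principal minors\<close>

definition rank1_sq :: "'a::comm_ring_1^'n \<Rightarrow> 'a^'n^'n" where
  "rank1_sq v = (\<chi> i j. v $ i * v $ j)"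

text \<open>The Leibniz formula on the index set \<open>K\<close> inside the full matrix, so that
  \<open>K\<close> can shrink one index at a time; \<open>K = UNIV\<close> gives
  \<open>det\<close>.\<close>

definition principal_minor :: "'n set \<Rightarrow> 'a::comm_ring_1^'n^'n \<Rightarrow> 'a" where
  "principal_minor K A = (\<Sum>p | p permutes K. of_int (sign p) * (\<Prod>i\<in>K. A $ i $ p i))"

text \<open>For symmetric matrices only, the following minors detect rank at most one.\<close>

definition rank_le1 :: "'a::comm_ring_1^'n^'n \<Rightarrow> bool" where
  "rank_le1 C \<longleftrightarrow> (\<forall>i j k. C $ i $ i * C $ j $ k = C $ i $ j * C $ i $ k)"

lemma sym_matsD: "A \<in> sym_mats \<Longrightarrow> A $ i $ j = A $ j $ i"
  by (metis (mono_tags, lifting) sym_mats_def mem_Collect_eq transpose_def vec_lambda_beta)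

lemma sym_matsI: "(\<And>i j. A $ i $ j = A $ j $ i) \<Longrightarrow> A \<in> sym_mats"
  by (simp add: sym_mats_def transpose_def vec_eq_iff)

lemma sym_mats_closed [simp]:
  "0 \<in> sym_mats"
  "mat 1 \<in> sym_mats"
  "rank1_sq v \<in> sym_mats"
  "A \<in> sym_mats \<Longrightarrow> B \<in> sym_mats \<Longrightarrow> A + B \<in> sym_mats"
  "A \<in> sym_mats \<Longrightarrow> B \<in> sym_mats \<Longrightarrow> A - B \<in> sym_mats"
  "A \<in> sym_mats \<Longrightarrow> - A \<in> sym_mats"
  "A \<in> sym_mats \<Longrightarrow> msmult c A \<in> sym_mats"
  by (auto simp: sym_mats_def transpose_def vec_eq_iff rank1_sq_def msmult_def mat_def mult.commute)

text \<open>Adding E_kk changes only the entry at (k, k), which occurs in the Leibniz terms of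
  exactly those permutations that fix \<open>k\<close>, that is, the permutations of
  \<open>K\<close>.\<close>

lemma principal_minor_insert_diff:
  fixes A :: "'a::comm_ring_1^'n^'n"
  assumes k: "k \<notin> K"
  shows "principal_minor (insert k K) (A + rank1_sq (axis k 1)) - principal_minor (insert k K) A
         = principal_minor K A"
proof -
  let ?E = "rank1_sq (axis k 1) :: 'a^'n^'n"
  have E: "(A + ?E) $ i $ j = A $ i $ j + (if i = k \<and> j = k then 1 else 0)" for i j
    by (simp add: rank1_sq_def axis_def)
  have fin: "finite K" by simp
  have *: "of_int (sign p) * (\<Prod>i\<in>insert k K. (A + ?E) $ i $ p i)
        - of_int (sign p) * (\<Prod>i\<in>insert k K. A $ i $ p i)
        = (if p k = k then of_int (sign p) * (\<Prod>i\<in>K. A $ i $ p i) else 0)" for p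
  proof -
    have "(\<Prod>i\<in>K. (A + ?E) $ i $ p i) = (\<Prod>i\<in>K. A $ i $ p i)"
      using k by (intro prod.cong) (auto simp: E simp del: vector_add_component)
    then show ?thesis
      using k fin by (simp add: E algebra_simps del: vector_add_component)
  qed
  have "principal_minor (insert k K) (A + ?E) - principal_minor (insert k K) A
      = (\<Sum>p | p permutes insert k K. if p k = k then of_int (sign p) * (\<Prod>i\<in>K. A $ i $ p i) else 0)"
    unfolding principal_minor_def sum_subtractf[symmetric] * ..
  also have "\<dots> = principal_minor K A"
    unfolding principal_minor_def
  proof (rule sum.mono_neutral_cong_right)
    show "finite {p. p permutes insert k K}" by (simp add: finite_permutations)
    show "{p. p permutes K} \<subseteq> {p. p permutes insert k K}"
      by (auto intro: permutes_subset)
    have "p permutes K" if "p permutes insert k K" "p k = k" for p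
      using that by (metis insertE permutes_superset Diff_iff insert_iff)
    then show "\<forall>i\<in>{p. p permutes insert k K} - {p. p permutes K}.
       (if i k = k then of_int (sign i) * (\<Prod>ia\<in>K. A $ ia $ i ia) else 0) = 0" by auto
    show "(if x k = k then of_int (sign x) * (\<Prod>i\<in>K. A $ i $ x i) else 0) =
         of_int (sign x) * (\<Prod>i\<in>K. A $ i $ x i)" if "x \<in> {p. p permutes K}" for x
      using that k by (auto simp: permutes_not_in)
  qed
  finally show ?thesis .
qed

lemma principal_minor_singleton: "principal_minor {i} A = A $ i $ i"
  by (simp add: principal_minor_def)

lemma permutes_empty_Collect: "{p. p permutes {}} = {id}"
  by auto

lemma principal_minor_pair:
  assumes "i \<noteq> j"
  shows "principal_minor {i, j} A = A $ i $ i * A $ j $ j - A $ i $ j * A $ j $ i"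
  using assms unfolding principal_minor_def
  by (simp add: sum_over_permutations_insert permutes_empty_Collect sign_swap_id sign_compose permutation_swap_id
      transpose_def)

lemma principal_minor_triple:
  assumes "i \<noteq> j" "i \<noteq> k" "j \<noteq> k"
  shows "principal_minor {i, j, k} A =
     A $ i $ i * (A $ j $ j * A $ k $ k - A $ j $ k * A $ k $ j)
   - A $ i $ j * (A $ j $ i * A $ k $ k - A $ j $ k * A $ k $ i)
   + A $ i $ k * (A $ j $ i * A $ k $ j - A $ j $ j * A $ k $ i)"
  using assms assms[symmetric] unfolding principal_minor_def
  by (simp add: sum_over_permutations_insert permutes_empty_Collect sign_swap_id sign_compose permutation_swap_id
      permutation_compose transpose_def algebra_simps)

section \<open>Determinants along rank-one directions and what they determine\<close>

text \<open>By multilinearity in the rows, a term that takes the update in two rows has two rows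
  proportional to \<open>v\<close> and vanishes, so no power of \<open>t\<close> above the first
  survives.\<close>

lemma det_rank1_update_affine:
  fixes B :: "'a::comm_ring_1^'n^'n"
  shows "\<exists>\<alpha> \<beta>. \<forall>t. det (B + msmult t (rank1_sq v)) = \<alpha> + \<beta> * t"
proof -
  \<comment> \<open>Rows in \<open>K\<close> carry the update, the other rows are free. This lets an
    induction over \<open>K\<close> replace a split-off row by \<open>B $ k\<close> or by
    \<open>v\<close>.\<close>
  define R :: "'n set \<Rightarrow> ('n \<Rightarrow> 'a^'n) \<Rightarrow> 'a \<Rightarrow> 'a^'n^'n" where
    "R K a t = (\<chi> i. if i \<in> K then B $ i + (t * v $ i) *s v else a i)" for K a t
  have ins: "det (R (insert k K) a t) = det (R K (a(k := B $ k)) t) + (t * v $ k) * det (R K (a(k := v)) t)"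
    if "k \<notin> K" for k K a t
  proof -
    let ?c = "\<lambda>i. if i \<in> K then B $ i + (t * v $ i) *s v else a i"
    have 1: "R (insert k K) a t = (\<chi> i. if i = k then B $ k + (t * v $ k) *s v else ?c i)"
      by (simp add: R_def vec_eq_iff)
    have 2: "R K (a(k := b)) t = (\<chi> i. if i = k then b else ?c i)" for b
      using that by (simp add: R_def vec_eq_iff)
    show ?thesis unfolding 1 2 by (simp add: det_row_add det_row_mul)
  qed
  \<comment> \<open>With \<open>v\<close> already present as a row outside \<open>K\<close>, every
    further \<open>t\<close>-term has two equal rows.\<close>
  have const: "\<forall>a i. i \<notin> K \<longrightarrow> a i = v \<longrightarrow> (\<forall>t. det (R K a t) = det (R K a 0))" if "finite K" for K
    using that
  proof (induction K)
    case empty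
    then show ?case by (simp add: R_def)
  next
    case (insert k K)
    show ?case
    proof (intro allI impI)
      fix a i t assume i: "i \<notin> insert k K" "a i = v"
      have ik: "i \<noteq> k" using i by auto
      have z: "det (R K (a(k := v)) s) = 0" for s
        by (rule det_identical_rows[OF ik])
          (use i insert ik in \<open>auto simp: R_def row_def vec_eq_iff\<close>)
      have "det (R K (a(k := B $ k)) t) = det (R K (a(k := B $ k)) 0)"
        using insert.IH i ik by (metis fun_upd_other insertCI)
      then show "det (R (insert k K) a t) = det (R (insert k K) a 0)"
        by (simp add: ins[OF insert(2)] z)
    qed
  qed
  have aff: "\<forall>a. \<exists>\<alpha> \<beta>. \<forall>t. det (R K a t) = \<alpha> + \<beta> * t" if "finite K" for K
    using that
  proof (induction K)
    case empty
    show ?case by (intro allI exI[of _ "det (R {} _ 0)"] exI[of _ 0]) (simp add: R_def)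
  next
    case (insert k K)
    show ?case
    proof
      fix a
      obtain \<alpha> \<beta> where ab: "\<And>t. det (R K (a(k := B $ k)) t) = \<alpha> + \<beta> * t"
        using insert.IH by blast
      define c where "c = det (R K (a(k := v)) 0)"
      have c: "det (R K (a(k := v)) t) = c" for t
        using const[OF insert(1)] insert(2) unfolding c_def by (metis fun_upd_same)
      show "\<exists>\<alpha> \<beta>. \<forall>t. det (R (insert k K) a t) = \<alpha> + \<beta> * t"
        by (intro exI[of _ \<alpha>] exI[of _ "\<beta> + v $ k * c"])
          (simp add: ins[OF insert(2)] ab c algebra_simps)
    qed
  qed
  have "R UNIV (\<lambda>_. 0) t = B + msmult t (rank1_sq v)" for t
    by (simp add: R_def vec_eq_iff msmult_def rank1_sq_def algebra_simps)
  with aff[of UNIV] show ?thesis by (metis finite)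
qed

text \<open>\<open>P\<close> is any property of scalar functions closed under subtraction, so that
  one argument serves both the equality of two matrices and affinity along a line.\<close>

lemma sym_mats_det_inherit:
  fixes M :: "'b \<Rightarrow> 'a::comm_ring_1^'n^'n"
  assumes P_diff: "\<And>f g. P f \<Longrightarrow> P g \<Longrightarrow> P (\<lambda>t. f t - g t)"
    and P_det: "\<And>A. A \<in> sym_mats \<Longrightarrow> P (\<lambda>t. det (A + M t))"
    and A: "A \<in> sym_mats"
  shows "P (\<lambda>t. principal_minor K (A + M t))"
proof -
  \<comment> \<open>Induction over the complement of the index set, starting from the full
    determinant and removing one index per difference.\<close>
  have "\<forall>A\<in>sym_mats. P (\<lambda>t. principal_minor (- L) (A + M t))" if "finite L" for L :: "'n set"
    using that
  proof (induction L)
    case empty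
    then show ?case using P_det by (simp add: principal_minor_def det_def)
  next
    case (insert k L)
    have eq: "insert k (- insert k L) = - L" using insert(2) by auto
    show ?case
    proof
      fix A :: "'a^'n^'n" assume A: "A \<in> sym_mats"
      have "P (\<lambda>t. principal_minor (- L) ((A + rank1_sq (axis k 1)) + M t)
                 - principal_minor (- L) (A + M t))"
        by (rule P_diff) (use insert.IH A in auto)
      moreover have "principal_minor (- L) ((A + rank1_sq (axis k 1)) + M t)
                 - principal_minor (- L) (A + M t) = principal_minor (- insert k L) (A + M t)" for t
        using principal_minor_insert_diff[of k "- insert k L" "A + M t"]
        unfolding eq by (simp add: ac_simps)
      ultimately show "P (\<lambda>t. principal_minor (- insert k L) (A + M t))" by simp
    qed
  qed
  from this[of "- K"] A show ?thesis by simp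
qed

text \<open>Shifting \<open>M t\<close> by the symmetric unit \<open>S\<close> and differencing
  principal minors isolates an off-diagonal entry (order 2) and a mixed minor (order 3), up to the
  invertible factors 4 and 2.\<close>

lemma det_inherit_entry:
  fixes M :: "'b \<Rightarrow> 'a::field^'n^'n"
  assumes char: "(2::'a) \<noteq> 0"
    and P_diff: "\<And>f g. P f \<Longrightarrow> P g \<Longrightarrow> P (\<lambda>t. f t - g t)"
    and P_scale: "\<And>f c. P f \<Longrightarrow> P (\<lambda>t. c * f t)"
    and P_det: "\<And>A. A \<in> sym_mats \<Longrightarrow> P (\<lambda>t. det (A + M t))"
    and M: "\<And>t. M t \<in> sym_mats"
  shows "P (\<lambda>t. M t $ i $ j)"
    and "P (\<lambda>t. M t $ i $ i * M t $ j $ k - M t $ i $ j * M t $ i $ k)"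
proof -
  have minor: "P (\<lambda>t. principal_minor K (A + M t))" if "A \<in> sym_mats" for A K
    by (rule sym_mats_det_inherit[where P = P and M = M, OF P_diff P_det that])
  have P_add: "P (\<lambda>t. f t + g t)" if "P f" "P g" for f g
    using P_diff[OF that(1) P_scale[OF that(2), of "-1"]] by simp
  have P_zero: "P (\<lambda>t. 0)"
    using P_scale[OF P_det[of 0], of 0] by simp
  have diag: "P (\<lambda>t. M t $ i $ i)" for i
    using minor[of 0 "{i}"] by (simp add: principal_minor_singleton)
  define S :: "'n \<Rightarrow> 'n \<Rightarrow> 'a^'n^'n" where
    "S i j = (\<chi> k l. if k = i \<and> l = j \<or> k = j \<and> l = i then 1 else 0)" for i j
  have S: "S i j \<in> sym_mats" for i j by (rule sym_matsI) (simp add: S_def disj_commute conj_commute)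
  have msym: "M t $ i $ j = M t $ j $ i" for t i j using sym_matsD[OF M] .
  have pair: "P (\<lambda>t. M t $ i $ i * M t $ j $ j - M t $ i $ j * M t $ i $ j)" if "i \<noteq> j" for i j
    using minor[of 0 "{i, j}"] that by (simp add: principal_minor_pair msym[of _ j i])
  have entry: "P (\<lambda>t. M t $ i $ j)" for i j
  proof (cases "i = j")
    case True
    then show ?thesis using diag by simp
  next
    case False
    have 1: "P (\<lambda>t. principal_minor {i, j} (- S i j + M t) - principal_minor {i, j} (S i j + M t))"
      by (intro P_diff minor) (auto simp: S)
    have 2: "principal_minor {i, j} (- S i j + M t) - principal_minor {i, j} (S i j + M t)
       = 4 * M t $ i $ j" for t
      using False by (simp add: principal_minor_pair S_def msym[of _ j i] algebra_simps)
    have "(4::'a) = 2 * 2" by simp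
    then have "(4::'a) \<noteq> 0" using char by (metis mult_eq_0_iff)
    then show ?thesis using P_scale[OF 1, of "1/4"] unfolding 2 by simp
  qed
  show "P (\<lambda>t. M t $ i $ j)" by (rule entry)
  show "P (\<lambda>t. M t $ i $ i * M t $ j $ k - M t $ i $ j * M t $ i $ k)"
  proof -
    consider "i = j" | "i = k" | "i \<noteq> j" "j = k" | "i \<noteq> j" "i \<noteq> k" "j \<noteq> k" by blast
    then show ?thesis
    proof cases
      case 1
      then show ?thesis using P_zero by simp
    next
      case 2
      then show ?thesis using P_zero by (simp add: mult.commute msym[of _ j k])
    next
      case 3
      then show ?thesis using pair by simp
    next
      case 4
      \<comment> \<open>Raising the entries at (j, k) and (k, j) by 1 lowers the minor by twice the
        wanted expression plus \<open>M t $ i $ i\<close>, hence the last subtraction.\<close>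
      have a: "P (\<lambda>t. principal_minor {i, j, k} (0 + M t) - principal_minor {i, j, k} (S j k + M t)
           - M t $ i $ i)"
        by (intro P_diff minor diag) (auto simp: S)
      have b: "principal_minor {i, j, k} (0 + M t) - principal_minor {i, j, k} (S j k + M t)
           - M t $ i $ i = 2 * (M t $ i $ i * M t $ j $ k - M t $ i $ j * M t $ i $ k)" for t
        using 4 by (simp add: principal_minor_triple S_def msym[of _ j i] msym[of _ k j] msym[of _ k i] algebra_simps)
      have c: "1 / 2 * (2 * x) = x" for x :: 'a using char by simp
      show ?thesis using P_scale[OF a, of "1/2"] unfolding b c .
    qed
  qed
qed

lemma sym_mats_eqI_det:
  fixes A B :: "'a::field^'n^'n"
  assumes char: "(2::'a) \<noteq> 0" and "A \<in> sym_mats" "B \<in> sym_mats"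
    and det: "\<And>Y. Y \<in> sym_mats \<Longrightarrow> det (A + Y) = det (B + Y)"
  shows "A = B"
proof -
  have "A $ i $ j = B $ i $ j" for i j
    \<comment> \<open>A Boolean parameter turns inheritance into equality: the property is to take
      the same value at \<open>True\<close> and \<open>False\<close>.\<close>
    using det_inherit_entry(1)[where P = "\<lambda>f. f True = f False" and M = "\<lambda>b. if b then A else B",
      OF char] assms by (simp add: add.commute)
  then show ?thesis by (simp add: vec_eq_iff)
qed

lemma affine_det_rank_le1:
  fixes M :: "'a::field \<Rightarrow> 'a^'n^'n"
  assumes char: "(2::'a) \<noteq> 0"
    and det: "\<And>A. A \<in> sym_mats \<Longrightarrow> \<exists>\<alpha> \<beta>. \<forall>t. det (A + M t) = \<alpha> + \<beta> * t"
    and M: "\<And>t. M t \<in> sym_mats"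
  obtains C where "rank_le1 C" "\<And>t. M t = M 0 + msmult t C"
proof -
  let ?P = "\<lambda>f :: 'a \<Rightarrow> 'a. \<exists>\<alpha> \<beta>. \<forall>t. f t = \<alpha> + \<beta> * t"
  have P_diff: "?P (\<lambda>t. f t - g t)" if fg: "?P f" "?P g" for f g
  proof -
    from fg obtain a b a' b' where "\<forall>t. f t = a + b * t" "\<forall>t. g t = a' + b' * t" by blast
    then show ?thesis
      by (intro exI[of _ "a - a'"] exI[of _ "b - b'"]) (simp add: algebra_simps)
  qed
  have P_scale: "?P (\<lambda>t. c * f t)" if f: "?P f" for f c
  proof -
    from f obtain a b where "\<forall>t. f t = a + b * t" by blast
    then show ?thesis
      by (intro exI[of _ "c * a"] exI[of _ "c * b"]) (simp add: algebra_simps)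
  qed
  note inh = det_inherit_entry[where P = ?P and M = M, OF char P_diff P_scale det M]
  define C where "C = M 1 - M 0"
  have line: "M t $ i $ j = M 0 $ i $ j + t * C $ i $ j" for t i j
  proof -
    from inh(1)[of i j] obtain a b where ab: "\<And>t. M t $ i $ j = a + b * t" by blast
    show ?thesis by (simp add: C_def ab)
  qed
  have "C $ i $ i * C $ j $ k = C $ i $ j * C $ i $ k" for i j k
  proof -
    from inh(2)[of i j k] obtain a b where ab:
      "\<And>t. M t $ i $ i * M t $ j $ k - M t $ i $ j * M t $ i $ k = a + b * t" by blast
    \<comment> \<open>The second difference of an affine function at -1, 0, 1 is zero; here it is
      twice the coefficient of t^2, which is the minor of \<open>C\<close>.\<close>
    have "2 * (C $ i $ i * C $ j $ k - C $ i $ j * C $ i $ k) = 0"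
      using ab[of 0] ab[of 1] ab[of "-1"]
      unfolding line[of 1] line[of "-1"] by (simp add: algebra_simps) algebra
    then show ?thesis using char by simp
  qed
  then have "rank_le1 C" unfolding rank_le1_def by blast
  moreover have "M t = M 0 + msmult t C" for t
    by (simp add: vec_eq_iff msmult_def line[of t])
  ultimately show ?thesis using that by blast
qed

section \<open>Matrices of rank at most one and lines of them\<close>

lemma rank_le1D: "rank_le1 C \<Longrightarrow> C $ i $ i * C $ j $ k = C $ i $ j * C $ i $ k"
  unfolding rank_le1_def by blast

lemma rank_le1_eq_zeroI:
  fixes C :: "'a::field^'n^'n"
  assumes "rank_le1 C" "\<And>i. C $ i $ i = 0"
  shows "C = 0"
  using assms by (simp add: rank_le1_def vec_eq_iff)

text \<open>A zero diagonal forces \<open>C = 0\<close>; otherwise the minors through a nonzero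
  pivot \<open>C $ i $ i\<close> express every entry by row \<open>i\<close>.\<close>

lemma rank_le1_obtain:
  fixes C :: "'a::field^'n^'n"
  assumes "rank_le1 C"
  obtains c w where "C = msmult c (rank1_sq w)"
proof (cases "\<exists>i. C $ i $ i \<noteq> 0")
  case True
  then obtain i where i: "C $ i $ i \<noteq> 0" by blast
  have "msmult (1 / C $ i $ i) (rank1_sq (C $ i)) $ j $ k = C $ j $ k" for j k
    using rank_le1D[OF assms, of i j k] i
    by (simp add: msmult_def rank1_sq_def nonzero_divide_eq_eq mult.commute)
  then have "msmult (1 / C $ i $ i) (rank1_sq (C $ i)) = C"
    unfolding vec_eq_iff by blast
  then show ?thesis by (rule that[OF sym])
next
  case False
  then have "C = msmult 0 (rank1_sq 0)"
    using rank_le1_eq_zeroI[OF assms] by (simp add: msmult_def vec_eq_iff)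
  then show ?thesis by (rule that)
qed

text \<open>Comparing coefficients of \<open>t\<close> in the minors shows that either
  \<open>D\<close> vanishes or \<open>B\<close> is a multiple of \<open>D\<close>; in the latter
  case the line passes through 0, which \<open>nz\<close> excludes.\<close>

lemma rank_le1_line_constant:
  fixes B D :: "'a::field^'n^'n"
  assumes char: "(2::'a) \<noteq> 0"
    and line: "\<And>t. rank_le1 (B + msmult t D)"
    and nz: "\<And>t. B + msmult t D \<noteq> 0"
  shows "D = 0"
proof -
  have q: "(B$i$i + t * D$i$i) * (B$j$k + t * D$j$k) = (B$i$j + t * D$i$j) * (B$i$k + t * D$i$k)"
    for t i j k
    using rank_le1D[OF line[of t], of i j k] by (simp add: msmult_def)
  have B: "B$i$i * B$j$k = B$i$j * B$i$k" for i j k using q[of i 0] by simp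
  have "2 * (D$i$i * D$j$k - D$i$j * D$i$k) = 0" for i j k
    using q[of i 1 j k] q[of i "-1" j k] B[of i j k] by algebra
  then have D: "D$i$i * D$j$k = D$i$j * D$i$k" for i j k using char by simp
  have mix: "B$i$i * D$j$k + D$i$i * B$j$k = B$i$j * D$i$k + D$i$j * B$i$k" for i j k
    using q[of i 1 j k] D[of i j k] B[of i j k] by algebra
  have "B \<noteq> 0" using nz[of 0] by (simp add: msmult_def vec_eq_iff)
  moreover have "rank_le1 B" unfolding rank_le1_def using B by blast
  ultimately obtain i where i: "B$i$i \<noteq> 0" using rank_le1_eq_zeroI by blast
  show ?thesis
  proof (cases "D$i$i = 0")
    case True
    then have "D$i$j = 0" for j using D[of i j j] by simp
    then show ?thesis using mix[of i] i True by (simp add: vec_eq_iff)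
  next
    case False
    \<comment> \<open>At \<open>t = - l\<close> the (i, i) entry is zero, so the minors force row
      \<open>i\<close> to vanish there, and \<open>mix\<close> carries this to all entries.\<close>
    define l where "l = B$i$i / D$i$i"
    have l: "B$i$i = l * D$i$i" using False by (simp add: l_def)
    have "(B$i$j - l * D$i$j)^2 = 0" for j
      using q[of i "-l" j j] l by (simp add: power2_eq_square)
    then have row: "B$i$j = l * D$i$j" for j by simp
    have "D$i$i * (B$j$k - l * D$j$k) = 0" for j k
      using mix[of i j k] D[of i j k] l row[of j] row[of k] by algebra
    then have "B + msmult (-l) D = 0" using False by (simp add: vec_eq_iff msmult_def)
    then show ?thesis using nz by blast
  qed
qed

section \<open>Scalar multiples, congruence and polarisation\<close>

lemma msmult_simps [simp]:
  "msmult 0 A = 0" "msmult c 0 = 0" "msmult 1 A = A" "msmult c A $ i $ j = c * A $ i $ j"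
  "msmult c (msmult d A) = msmult (c * d) A"
  by (simp_all add: msmult_def vec_eq_iff mult.assoc)

lemma msmult_algebra:
  "msmult c (A + B) = msmult c A + msmult c B"
  "msmult c (A - B) = msmult c A - msmult c B"
  "msmult (c + d) A = msmult c A + msmult d A"
  by (simp_all add: msmult_def vec_eq_iff algebra_simps)

lemma msmult_matrix_mult:
  "msmult c A ** B = msmult c (A ** B)" "A ** msmult c B = msmult c (A ** B)"
  by (simp_all add: msmult_def matrix_matrix_mult_def vec_eq_iff sum_distrib_left mult.assoc mult.left_commute)

lemma matrix_mult_add_rdistrib: "(A + B) ** C = A ** C + B ** (C :: 'a::comm_ring_1^'n^'m)"
  by (simp add: matrix_matrix_mult_def vec_eq_iff distrib_right sum.distrib)

lemma rank1_sq_component [simp]: "rank1_sq v $ i $ j = v $ i * v $ j"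
  by (simp add: rank1_sq_def)

lemma conj_rank1_sq: "V ** rank1_sq w ** transpose V = rank1_sq (V *v w)"
proof -
  have 1: "(V ** rank1_sq w) $ k $ a = (V *v w) $ k * w $ a" for k a
    by (simp add: matrix_matrix_mult_def matrix_vector_mult_def sum_distrib_right mult.assoc)
  have "(V ** rank1_sq w ** transpose V) $ k $ l = (V *v w) $ k * (V *v w) $ l" for k l
  proof -
    have "(V ** rank1_sq w ** transpose V) $ k $ l = (\<Sum>a\<in>UNIV. (V *v w) $ k * (V $ l $ a * w $ a))"
      unfolding matrix_matrix_mult_def[of "V ** rank1_sq w"] by (simp add: 1 transpose_def mult_ac)
    also have "\<dots> = (V *v w) $ k * (\<Sum>a\<in>UNIV. V $ l $ a * w $ a)"
      by (rule sum_distrib_left[symmetric])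
    finally show ?thesis by (simp add: matrix_vector_mult_def)
  qed
  then show ?thesis by (simp add: vec_eq_iff)
qed

lemma det_msmult: "det (msmult c A) = c ^ CARD('n) * det (A :: 'a::comm_ring_1^'n^'n)"
proof -
  have "msmult c A = (\<chi> i. c *s (A $ i))"
    by (simp add: vec_eq_iff)
  then show ?thesis using det_rows_mul[of "\<lambda>_. c" "\<lambda>i. A $ i"] by simp
qed

text \<open>Polarisation: \<open>x\<^sub>i\<^sub>j (E\<^sub>i\<^sub>j + E\<^sub>j\<^sub>i)\<close> is a combination of the squares of \<open>e\<^sub>i + e\<^sub>j\<close>, \<open>e\<^sub>i\<close> and \<open>e\<^sub>j\<close>.\<close>

lemma sym_mats_induct [consumes 2, case_names zero diag offdiag]:
  fixes X :: "'a::field^'n^'n"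
  assumes char: "(2::'a) \<noteq> 0" and X: "X \<in> sym_mats"
    and zero: "P 0"
    and diag: "\<And>Y t i. Y \<in> sym_mats \<Longrightarrow> P Y \<Longrightarrow> P (Y + msmult t (rank1_sq (axis i 1)))"
    and offdiag: "\<And>Y t i j. Y \<in> sym_mats \<Longrightarrow> i \<noteq> j \<Longrightarrow> P Y \<Longrightarrow>
        P (Y + msmult t (rank1_sq (axis i 1 + axis j 1)))"
  shows "P X"
proof -
  \<comment> \<open>This is half of \<open>X $ i $ j\<close> times E_ij + E_ji: the sum over all
    ordered pairs meets each off-diagonal position twice.\<close>
  define G where "G i j = msmult (X $ i $ j / 2) (rank1_sq (axis i 1 + axis j 1))
      + msmult (- (X $ i $ j / 2)) (rank1_sq (axis i 1))
      + msmult (- (X $ i $ j / 2)) (rank1_sq (axis j 1))" for i j :: 'n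
  have four: "rank1_sq (axis i 1 + axis i 1) = msmult 4 (rank1_sq (axis i 1) :: 'a^'n^'n)" for i
    by (simp add: vec_eq_iff axis_def)
  have "sum (case_prod G) S \<in> sym_mats \<and> P (sum (case_prod G) S)" if "finite S" for S
    using that
  proof (induction S)
    case empty
    then show ?case using zero by simp
  next
    case (insert p S)
    obtain i j where p: "p = (i, j)" by (cases p)
    let ?Y = "sum (case_prod G) S"
    have Y: "?Y \<in> sym_mats" "P ?Y" using insert by auto
    have 1: "P (?Y + msmult (X $ i $ j / 2) (rank1_sq (axis i 1 + axis j 1)))"
    proof (cases "i = j")
      case True
      show ?thesis unfolding True four msmult_simps by (rule diag[OF Y])
    next
      case False
      then show ?thesis using offdiag[OF Y(1) _ Y(2)] by simp
    qed
    have "P (Z + G i j)"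
      if "Z \<in> sym_mats" "P (Z + msmult (X $ i $ j / 2) (rank1_sq (axis i 1 + axis j 1)))" for Z
      unfolding G_def add.assoc[symmetric] by (intro diag that sym_mats_closed)
    from this[OF Y(1) 1] have "P (?Y + G i j)" .
    moreover have "G i j \<in> sym_mats" by (simp add: G_def)
    ultimately show ?case using insert Y by (simp add: p add.commute)
  qed
  moreover have "sum (case_prod G) UNIV = X"
  proof -
    have G: "G i j $ k $ l = (if k = i then if l = j then X $ i $ j / 2 else 0 else 0)
        + (if l = i then if k = j then X $ i $ j / 2 else 0 else 0)" for i j k l
    proof -
      have "h * ((a + b) * (c + d)) + - h * (a * c) + - h * (b * d) = h * (a * d + b * c)"
        for h a b c d :: 'a
        by (simp add: algebra_simps)
      then have "G i j $ k $ l = X $ i $ j / 2 * (axis i 1 $ k * axis j 1 $ l + axis j 1 $ k * axis i 1 $ l)"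
        unfolding G_def vector_add_component msmult_simps(4) rank1_sq_component .
      then show ?thesis
        by (cases "k = i"; cases "l = j"; cases "k = j"; cases "l = i"; simp add: axis_def)
    qed
    have "sum (case_prod G) UNIV $ k $ l = X $ k $ l" for k l
    proof -
      have "sum (case_prod G) UNIV $ k $ l = (\<Sum>i\<in>UNIV. \<Sum>j\<in>UNIV. G i j $ k $ l)"
        by (simp add: sum.cartesian_product split_def)
      also have "\<dots> = (\<Sum>i\<in>UNIV. \<Sum>j\<in>UNIV. if k = i then if l = j then X $ i $ j / 2 else 0 else 0)
          + (\<Sum>i\<in>UNIV. \<Sum>j\<in>UNIV. if l = i then if k = j then X $ i $ j / 2 else 0 else 0)"
        unfolding sum.distrib[symmetric] G ..
      also have "\<dots> = X $ k $ l / 2 + X $ l $ k / 2"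
      proof -
        have half: "(\<Sum>i\<in>UNIV. \<Sum>j\<in>UNIV. if k = i then if l = j then X $ i $ j / 2 else 0 else 0) = X $ k $ l / 2" for k l
        proof -
          have "(\<Sum>j\<in>UNIV. if k = i then if l = j then X $ i $ j / 2 else 0 else 0)
             = (if k = i then X $ i $ l / 2 else 0)" for i
            by simp
          then show ?thesis by simp
        qed
        show ?thesis by (simp only: half)
      qed
      also have "\<dots> = X $ k $ l"
        using char sym_matsD[OF X, of l k] by (simp add: field_simps)
      finally show ?thesis .
    qed
    then show ?thesis by (simp add: vec_eq_iff)
  qed
  ultimately show ?thesis by (metis finite)
qed

section \<open>The linear part of a determinant-preserving pair\<close>

lemma det_preserving_pair_linear:
  fixes \<phi> \<psi> :: "'a::field^'n^'n \<Rightarrow> 'a^'n^'n"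
  assumes char: "(2::'a) \<noteq> 0"
    and phi_into: "\<And>x. x \<in> sym_mats \<Longrightarrow> \<phi> x \<in> sym_mats"
    and surj: "\<psi> ` sym_mats = sym_mats"
    and det_pres: "\<And>x y. x \<in> sym_mats \<Longrightarrow> y \<in> sym_mats \<Longrightarrow> det (\<phi> x + \<psi> y) = det (x + y)"
  obtains L where "\<And>x. x \<in> sym_mats \<Longrightarrow> \<phi> x = L x + \<phi> 0"
    "\<And>x y. x \<in> sym_mats \<Longrightarrow> y \<in> sym_mats \<Longrightarrow> L (x + y) = L x + L y"
    "\<And>c x. x \<in> sym_mats \<Longrightarrow> L (msmult c x) = msmult c (L x)"
    "\<And>v. rank_le1 (L (rank1_sq v))"
    "\<And>x. x \<in> sym_mats \<Longrightarrow> det (L x) = det x"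
proof -
  \<comment> \<open>Through \<open>det_pres\<close>, \<open>\<phi> x\<close> fixes all values
    \<open>det (x + Y)\<close>, hence \<open>x\<close>.\<close>
  have inj: "x = x'" if "x \<in> sym_mats" "x' \<in> sym_mats" "\<phi> x = \<phi> x'" for x x'
  proof (rule sym_mats_eqI_det[OF char that(1,2)])
    show "det (x + Y) = det (x' + Y)" if "Y \<in> sym_mats" for Y
      using det_pres[of x Y] det_pres[of x' Y] that \<open>x \<in> sym_mats\<close> \<open>x' \<in> sym_mats\<close> \<open>\<phi> x = \<phi> x'\<close> by simp
  qed
  have "\<exists>C. rank_le1 C \<and> (\<forall>t. \<phi> (x + msmult t (rank1_sq v)) = \<phi> x + msmult t C)"
    if x: "x \<in> sym_mats" for x v
  proof -
    let ?M = "\<lambda>t. \<phi> (x + msmult t (rank1_sq v))"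
    have M: "?M t \<in> sym_mats" for t by (intro phi_into) (simp add: x)
    \<comment> \<open>Surjectivity of \<open>\<psi>\<close> realises every shift \<open>A\<close> as
      some \<open>\<psi> y\<close>, which turns this into a determinant along a rank-one direction
      at \<open>x + y\<close>.\<close>
    have aff: "\<exists>\<alpha> \<beta>. \<forall>t. det (A + ?M t) = \<alpha> + \<beta> * t" if "A \<in> sym_mats" for A
    proof -
      have "A \<in> \<psi> ` sym_mats" using that by (simp only: surj)
      then obtain y where y: "A = \<psi> y" "y \<in> sym_mats" by (rule imageE)
      have "det (A + ?M t) = det ((x + y) + msmult t (rank1_sq v))" for t
        using det_pres[of "x + msmult t (rank1_sq v)" y] x y by (simp add: ac_simps)
      then show ?thesis using det_rank1_update_affine[of "x + y" v] by simp
    qed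
    obtain C where "rank_le1 C" "\<And>t. ?M t = ?M 0 + msmult t C"
      using affine_det_rank_le1[OF char aff M] by blast
    then show ?thesis by (intro exI[of _ C]) simp
  qed
  then obtain C where C_rk: "\<And>x v. x \<in> sym_mats \<Longrightarrow> rank_le1 (C x v)"
    and C: "\<And>x v t. x \<in> sym_mats \<Longrightarrow> \<phi> (x + msmult t (rank1_sq v)) = \<phi> x + msmult t (C x v)"
    by metis
  have C_nz: "C x v \<noteq> 0" if x: "x \<in> sym_mats" and v: "v \<noteq> 0" for x v
  proof
    assume "C x v = 0"
    then have "\<phi> (x + msmult 1 (rank1_sq v)) = \<phi> x" using C[OF x, of 1 v] by simp
    then have "rank1_sq v = 0" using inj[of "x + msmult 1 (rank1_sq v)" x] x by simp
    then show False using v by (simp add: vec_eq_iff)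
  qed
  \<comment> \<open>Adding the two squares to \<open>x\<close> in either order shows that
    \<open>C\<close> varies affinely in \<open>s\<close>; this line stays at rank exactly one, so it
    is constant.\<close>
  have C_step: "C (x + msmult s (rank1_sq w)) v = C x v" if x: "x \<in> sym_mats" and v: "v \<noteq> 0" for x s w v
  proof -
    define D where "D = C (x + msmult 1 (rank1_sq v)) w - C x w"
    have line: "C (x + msmult s (rank1_sq w)) v = C x v + msmult s D" for s
    proof -
      let ?V = "msmult 1 (rank1_sq v) :: 'a^'n^'n" and ?W = "msmult s (rank1_sq w) :: 'a^'n^'n"
      have "\<phi> (x + ?W + ?V) = \<phi> x + msmult s (C x w) + C (x + ?W) v"
        by (subst C) (use x C in auto)
      moreover have "\<phi> (x + ?V + ?W) = \<phi> x + C x v + msmult s (C (x + ?V) w)"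
        by (subst C) (use x C[OF x, of 1 v] in auto)
      moreover have "x + ?W + ?V = x + ?V + ?W" by (simp add: ac_simps)
      ultimately have "\<phi> x + msmult s (C x w) + C (x + ?W) v = \<phi> x + C x v + msmult s (C (x + ?V) w)"
        by metis
      then show ?thesis by (simp add: D_def msmult_algebra algebra_simps)
    qed
    have "D = 0"
    proof (rule rank_le1_line_constant[OF char])
      show "rank_le1 (C x v + msmult t D)" for t
        unfolding line[symmetric] by (rule C_rk) (simp add: x)
      show "C x v + msmult t D \<noteq> 0" for t
        unfolding line[symmetric] by (rule C_nz) (simp_all add: x v)
    qed
    then show ?thesis using line by simp
  qed
  have C_const: "C x v = C 0 v" if x: "x \<in> sym_mats" and v: "v \<noteq> 0" for x v
    using char x by (induction rule: sym_mats_induct) (simp_all add: C_step v)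
  define L where "L x = \<phi> x - \<phi> 0" for x
  have L0: "L 0 = 0" by (simp add: L_def)
  have L_rank1: "L (x + msmult t (rank1_sq v)) = L x + msmult t (C 0 v)"
    if x: "x \<in> sym_mats" and v: "v \<noteq> 0" for x t v
    using C[OF x, of t v] C_const[OF x v] by (simp add: L_def)
  have ax: "axis i (1::'a) \<noteq> 0" for i :: 'n by (metis axis_eq_0_iff one_neq_zero)
  have ax2: "axis i 1 + axis j (1::'a) \<noteq> 0" if "i \<noteq> j" for i j :: 'n
  proof
    assume "axis i 1 + axis j (1::'a) = 0"
    then have "(axis i 1 + axis j (1::'a)) $ i = 0" by simp
    then show False using that by (simp add: axis_def)
  qed
  have L_add: "L (x + y) = L x + L y" if x: "x \<in> sym_mats" and y: "y \<in> sym_mats" for x y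
    using char y
  proof (induction rule: sym_mats_induct)
    case zero
    then show ?case by (simp add: L0)
  next
    case (diag Y t i)
    then show ?case using L_rank1[OF _ ax, of "x + Y" t i] L_rank1[OF _ ax, of Y t i] x
      by (simp add: add.assoc)
  next
    case (offdiag Y t i j)
    then show ?case using L_rank1[OF _ ax2[of i j], of "x + Y" t] L_rank1[OF _ ax2[of i j], of Y t] x
      by (simp add: add.assoc)
  qed
  have L_gen: "L (msmult t (rank1_sq v)) = msmult t (C 0 v)" if "v \<noteq> 0" for t v
    using L_rank1[of 0 v t] that by (simp add: L0)
  have L_scale: "L (msmult c x) = msmult c (L x)" if x: "x \<in> sym_mats" for c x
    using char x
    by (induction rule: sym_mats_induct)
      (simp_all add: L0 L_add L_gen ax ax2 msmult_algebra)
  have L_rk: "rank_le1 (L (rank1_sq v))" for v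
  proof (cases "v = 0")
    case True
    then have "rank1_sq v = 0" by (simp add: vec_eq_iff)
    then show ?thesis by (simp add: L0 rank_le1_def)
  next
    case False
    then show ?thesis using L_gen[of v 1] C_rk[of 0 v] by simp
  qed
  \<comment> \<open>A \<open>y0\<close> with \<open>\<psi> y0 = - \<phi> 0\<close> cancels the
    constant part of \<open>\<phi>\<close> and leaves \<open>det (L x) = det (x + y0)\<close>; it
    remains to show that \<open>y0\<close> is zero.\<close>
  have "- \<phi> 0 \<in> \<psi> ` sym_mats" unfolding surj by (simp add: phi_into)
  then obtain y0 where "- \<phi> 0 = \<psi> y0" and y0_sym: "y0 \<in> sym_mats" by (rule imageE)
  then have y0: "y0 \<in> sym_mats" "\<psi> y0 = - \<phi> 0" by simp_all
  have L_det': "det (L x) = det (x + y0)" if "x \<in> sym_mats" for x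
    using det_pres[OF that y0(1)] y0(2) by (simp add: L_def)
  have neg: "- x = msmult (-1) x" for x :: "'a^'n^'n" by (simp add: vec_eq_iff)
  have det_neg: "det (- x) = (-1) ^ CARD('n) * det x" for x :: "'a^'n^'n"
    unfolding neg det_msmult ..
  text \<open>Both sides of \<open>L_det'\<close> change by the same sign under \<open>x \<mapsto> - x\<close>, which makes
    \<open>y0\<close> and \<open>- y0\<close> indistinguishable.\<close>
  have "y0 = - y0"
  proof (rule sym_mats_eqI_det[OF char])
    fix Y :: "'a^'n^'n" assume Y: "Y \<in> sym_mats"
    have "det (- Y + y0) = det (L (- Y))" using Y by (simp add: L_det')
    also have "L (- Y) = - L Y" unfolding neg using L_scale[OF Y] .
    also have "det (- L Y) = (-1) ^ CARD('n) * det (Y + y0)"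
      using L_det'[OF Y] by (simp add: det_neg)
    finally have "det (- Y + y0) = (-1) ^ CARD('n) * det (Y + y0)" .
    moreover have "det (- Y + y0) = (-1) ^ CARD('n) * det (Y - y0)"
      using det_neg[of "Y - y0"] by (simp add: algebra_simps)
    ultimately show "det (y0 + Y) = det (- y0 + Y)" by (simp add: algebra_simps)
  qed (simp_all add: y0)
  then have "2 * y0 $ i $ j = 0" for i j
    by (metis add.right_inverse mult_2 vector_uminus_component)
  then have "y0 = 0" using char by (simp add: vec_eq_iff)
  then have "det (L x) = det x" if "x \<in> sym_mats" for x using L_det'[OF that] by simp
  then show ?thesis using that[of L] L_add L_scale L_rk by (simp add: L_def)
qed

section \<open>Linear maps normalised on the diagonal units\<close>

text \<open>The roots of s^3 - s are 0, 1 and -1, which cannot exhaust five elements. Such an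
  \<open>s\<close> separates the first from the third power of a parameter.\<close>

lemma exists_cube_neq_self:
  assumes "infinite (UNIV :: 'a::field set) \<or> CARD('a::field) \<ge> 5"
  obtains s :: "'a::field" where "s ^ 3 \<noteq> s"
proof -
  have "card {0, 1, -1 :: 'a} \<le> 3" by (simp add: card_insert_if)
  with assms have "{0, 1, -1 :: 'a} \<noteq> UNIV"
    by (metis finite.emptyI finite.insertI not_numeral_le_zero numeral_le_iff order_trans semiring_norm(69,71,73))
  then obtain s :: 'a where s: "s \<noteq> 0" "s \<noteq> 1" "s \<noteq> -1" by blast
  have "s ^ 3 - s = s * ((s - 1) * (s + 1))" by (simp add: power3_eq_cube algebra_simps)
  also have "\<dots> \<noteq> 0" using s by (simp add: eq_neg_iff_add_eq_0)
  finally show ?thesis using that[of s] by simp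
qed

lemma rank1_sq_axis_component: "rank1_sq (axis i 1) $ k $ l = (if k = i \<and> l = i then 1 else 0 :: 'a::comm_ring_1)"
  by (simp add: axis_def)

text \<open>The pencil \<open>K ((e\<^sub>i + s e\<^sub>j) (e\<^sub>i + s e\<^sub>j)\<^sup>t)\<close> has rank at most one for every \<open>s\<close>; comparing
  powers of \<open>s\<close> in its minors kills all entries of the image of \<open>E\<^sub>i\<^sub>j + E\<^sub>j\<^sub>i\<close> except two.\<close>

lemma offdiag_image_support:
  fixes K :: "'a::field^'n^'n \<Rightarrow> 'a^'n^'n"
  assumes char: "(2::'a) \<noteq> 0"
    and card: "infinite (UNIV::'a set) \<or> CARD('a) \<ge> 5"
    and K_add: "\<And>x y. x \<in> sym_mats \<Longrightarrow> y \<in> sym_mats \<Longrightarrow> K (x + y) = K x + K y"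
    and K_scale: "\<And>c x. x \<in> sym_mats \<Longrightarrow> K (msmult c x) = msmult c (K x)"
    and K_rk: "\<And>v. rank_le1 (K (rank1_sq v))"
    and K_diag: "\<And>i. K (rank1_sq (axis i 1)) = msmult (c i) (rank1_sq (axis i 1))"
    and c: "\<And>i. c i \<noteq> 0" and ij: "i \<noteq> j"
  shows "k = l \<Longrightarrow> K (rank1_sq (axis i 1 + axis j 1)) $ k $ l
      = c k * rank1_sq (axis i 1 + axis j 1) $ k $ l"
    and "\<not> (k = i \<and> l = j) \<Longrightarrow> \<not> (k = j \<and> l = i) \<Longrightarrow> k \<noteq> l \<Longrightarrow>
      K (rank1_sq (axis i 1 + axis j 1)) $ k $ l = 0"
proof -
  let ?E = "\<lambda>i. rank1_sq (axis i 1) :: 'a^'n^'n"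
  let ?S = "rank1_sq (axis i 1 + axis j 1) :: 'a^'n^'n"
  \<comment> \<open>The image of E_ij + E_ji, which is the coefficient of \<open>s\<close> in the
    pencil \<open>R s\<close>.\<close>
  define B where "B = K ?S - msmult (c i) (?E i) - msmult (c j) (?E j)"
  define R where "R s = K (rank1_sq (axis i 1 + s *s axis j 1))" for s
  have R: "R s $ k $ l = (if k = i \<and> l = i then c i else 0) + s * B $ k $ l
      + (if k = j \<and> l = j then s^2 * c j else 0)" for s k l
  proof -
    have "rank1_sq (axis i 1 + s *s axis j 1)
        = msmult (1 - s) (?E i) + msmult s ?S + msmult (s^2 - s) (?E j)"
      by (simp add: vec_eq_iff axis_def power2_eq_square algebra_simps)
    then have "R s = msmult ((1 - s) * c i) (?E i) + msmult s (K ?S) + msmult ((s^2 - s) * c j) (?E j)"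
      by (simp add: R_def K_add K_scale K_diag)
    then show ?thesis
      by (simp add: B_def rank1_sq_axis_component algebra_simps del: rank1_sq_component)
  qed
  have R_rk: "R s $ a $ a * R s $ b $ d = R s $ a $ b * R s $ a $ d" for s a b d
    unfolding R_def by (rule rank_le1D[OF K_rk])
  \<comment> \<open>Passing from parameter 1 to -1 preserves the squared entry; comparing both
    minors gives \<open>c i * B $ a $ a = 0\<close>, and a zero diagonal entry clears its
    row.\<close>
  have B_sym_sq: "B $ a $ b = 0" if a: "a \<noteq> i" "a \<noteq> j" for a b
  proof -
    have "(c i + B $ i $ i) * B $ a $ a = (B $ i $ a)^2"
      and "(c i - B $ i $ i) * - B $ a $ a = (B $ i $ a)^2"
      using R_rk[of 1 i a a] R_rk[of "-1" i a a] a ij unfolding R by (simp_all add: power2_eq_square)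
    then have "2 * (c i * B $ a $ a) = 0" by algebra
    then have "B $ a $ a = 0" using char c by simp
    then show ?thesis using R_rk[of 1 a b b] a unfolding R by auto
  qed
  \<comment> \<open>In the minor on \<open>i\<close> and \<open>j\<close>, the parameters 1 and -1
    show that the coefficients of t and t^3 are opposite; an \<open>s\<close> with
    \<open>s ^ 3 \<noteq> s\<close> then makes both vanish.\<close>
  have diag0: "B $ i $ i = 0 \<and> B $ j $ j = 0"
  proof -
    obtain s :: 'a where s: "s ^ 3 \<noteq> s" using exists_cube_neq_self[OF card] .
    have q: "(c i + t * B $ i $ i) * (t * B $ j $ j + t^2 * c j) = (t * B $ i $ j)^2" for t
      using R_rk[of t i j j] ij unfolding R by (simp add: power2_eq_square)
    have q1: "(c i + B $ i $ i) * (B $ j $ j + c j) = (B $ i $ j)^2"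
      using q[of 1] by simp
    have q2: "(c i - B $ i $ i) * (c j - B $ j $ j) = (B $ i $ j)^2"
      using q[of "-1"] by simp
    have "2 * (c i * B $ j $ j + B $ i $ i * c j) = 0"
      using q1 q2 by algebra
    then have 1: "c i * B $ j $ j + B $ i $ i * c j = 0" using char by (metis mult_eq_0_iff)
    have 2: "c i * c j + B $ i $ i * B $ j $ j = (B $ i $ j)^2"
      using q1 1 by algebra
    have "(s ^ 3 - s) * (B $ i $ i * c j) = 0"
      using q[of s] 1 2 by algebra
    then have "B $ i $ i = 0" using s c by simp
    then show ?thesis using 1 c by simp
  qed
  have KS: "K ?S $ k $ l = B $ k $ l + (if k = i \<and> l = i then c i else 0) + (if k = j \<and> l = j then c j else 0)" for k l
    by (simp add: B_def rank1_sq_axis_component del: rank1_sq_component)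
  have Bkk: "B $ k $ k = 0" for k using diag0 B_sym_sq by metis
  show "k = l \<Longrightarrow> K ?S $ k $ l = c k * ?S $ k $ l"
  proof -
    assume "k = l"
    have "?S $ k $ k = (if k = i \<or> k = j then 1 else 0)"
      using ij by (simp add: axis_def)
    with \<open>k = l\<close> show ?thesis
      using Bkk[of k] ij by (auto simp: KS simp del: rank1_sq_component)
  qed
  have Bz: "B $ k $ l = 0" if "\<not> (k = i \<and> l = j)" "\<not> (k = j \<and> l = i)" "k \<noteq> l" for k l
  proof (cases "k = i \<or> k = j")
    case False
    then show ?thesis using B_sym_sq by blast
  next
    case True
    then have l: "l \<noteq> i" "l \<noteq> j" using that by auto
    have "R 1 $ k $ k * R 1 $ l $ l = R 1 $ k $ l * R 1 $ k $ l" by (rule R_rk)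
    moreover have "R 1 $ l $ l = 0" using l B_sym_sq[OF l] by (simp add: R)
    ultimately have "R 1 $ k $ l = 0" by simp
    then show ?thesis using that l by (simp add: R)
  qed
  then show "\<not> (k = i \<and> l = j) \<Longrightarrow> \<not> (k = j \<and> l = i) \<Longrightarrow> k \<noteq> l \<Longrightarrow> K ?S $ k $ l = 0"
    by (auto simp: KS)
qed

text \<open>Such a \<open>K\<close> is entrywise multiplication by a matrix \<open>m\<close> of rank
  one, which amounts to a scaled congruence by a diagonal matrix.\<close>

lemma det_preserver_diag_normalized:
  fixes K :: "'a::field^'n^'n \<Rightarrow> 'a^'n^'n"
  assumes char: "(2::'a) \<noteq> 0"
    and card: "infinite (UNIV::'a set) \<or> CARD('a) \<ge> CARD('n)^2 + 1"
    and K_add: "\<And>x y. x \<in> sym_mats \<Longrightarrow> y \<in> sym_mats \<Longrightarrow> K (x + y) = K x + K y"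
    and K_scale: "\<And>c x. x \<in> sym_mats \<Longrightarrow> K (msmult c x) = msmult c (K x)"
    and K_rk: "\<And>v. rank_le1 (K (rank1_sq v))"
    and K_diag: "\<And>i. K (rank1_sq (axis i 1)) = msmult (c i) (rank1_sq (axis i 1))"
    and c: "\<And>i. c i \<noteq> 0"
  obtains \<beta> D where "\<And>x. x \<in> sym_mats \<Longrightarrow> K x = msmult \<beta> (D ** x ** transpose D)"
proof -
  let ?S = "\<lambda>i j. rank1_sq (axis i 1 + axis j 1) :: 'a^'n^'n"
  \<comment> \<open>The diagonal needs its own case, since \<open>?S k k\<close> is 4 E_kk.\<close>
  define m where "m k l = (if k = l then c k else K (?S k l) $ k $ l)" for k l
  have KS: "K (?S i j) $ k $ l = m k l * ?S i j $ k $ l" if ij: "i \<noteq> j" for i j k l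
  proof -
    \<comment> \<open>Two distinct indices give n \<ge> 2, so the bound n^2 + 1 supplies the five
      scalars that separate powers.\<close>
    have "2 \<le> CARD('n)"
      using card_mono[of UNIV "{i, j}"] ij by simp
    then have "2 ^ 2 \<le> CARD('n) ^ 2" by (rule power_mono) simp
    then have five: "infinite (UNIV::'a set) \<or> CARD('a) \<ge> 5" using card by auto
    have supp1: "k = l \<Longrightarrow> K (?S i j) $ k $ l = c k * ?S i j $ k $ l"
      by (rule offdiag_image_support(1)[OF char five K_add K_scale K_rk K_diag c ij]; assumption)
    have supp2: "\<not> (k = i \<and> l = j) \<Longrightarrow> \<not> (k = j \<and> l = i) \<Longrightarrow> k \<noteq> l \<Longrightarrow> K (?S i j) $ k $ l = 0"
      by (rule offdiag_image_support(2)[OF char five K_add K_scale K_rk K_diag c ij]; assumption)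
    consider "k = l" | "k = i" "l = j" | "k = j" "l = i"
      | "k \<noteq> l" "\<not> (k = i \<and> l = j)" "\<not> (k = j \<and> l = i)" by blast
    then show ?thesis
    proof cases
      case 1
      then show ?thesis using supp1 by (simp add: m_def)
    next
      case 2
      then show ?thesis using ij by (simp add: m_def axis_def)
    next
      case 3
      then show ?thesis using ij by (simp add: m_def axis_def add.commute)
    next
      case 4
      then show ?thesis using supp2 by (auto simp: axis_def)
    qed
  qed
  have K0: "K 0 = 0" using K_scale[of 0 0] by simp
  have Km: "K x $ k $ l = m k l * x $ k $ l" if "x \<in> sym_mats" for x k l
    using char that
  proof (induction rule: sym_mats_induct)
    case zero
    then show ?case by (simp add: K0)
  next
    case (diag Y t i)
    then have "K (Y + msmult t (rank1_sq (axis i 1))) $ k $ l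
        = m k l * Y $ k $ l + t * (c i * rank1_sq (axis i 1) $ k $ l)"
      by (simp add: K_add K_scale K_diag del: rank1_sq_component)
    then show ?case
      by (auto simp: rank1_sq_axis_component m_def algebra_simps simp del: rank1_sq_component)
  next
    case (offdiag Y t i j)
    then show ?case
      by (simp add: K_add K_scale KS algebra_simps del: rank1_sq_component)
  qed
  \<comment> \<open>The all-ones matrix is the square of the all-ones vector and its image is
    \<open>m\<close> itself.\<close>
  have mm: "m p p * m k l = m p k * m p l" for p k l
    using rank_le1D[OF K_rk[of "\<chi> i. 1"], of p k l] by (simp add: Km)
  fix p :: 'n
  \<comment> \<open>Row \<open>p\<close> of \<open>m\<close>, for an arbitrary pivot
    \<open>p\<close>, provides the diagonal: by \<open>mm\<close>, \<open>m k l\<close> is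
    \<open>m p k * m p l / m p p\<close>.\<close>
  define D :: "'a^'n^'n" where "D = (\<chi> i j. if i = j then m p i else 0)"
  have D_left: "(D ** x) $ k $ l = m p k * x $ k $ l" for x k l
    by (simp add: D_def matrix_matrix_mult_def if_distrib[of "\<lambda>y. y * _"] cong: if_cong)
  have D_conj: "(D ** x ** transpose D) $ k $ l = m p k * x $ k $ l * m p l" for x k l
  proof -
    have "(D ** x ** transpose D) $ k $ l = (\<Sum>a\<in>UNIV. (D ** x) $ k $ a * D $ l $ a)"
      by (simp add: matrix_matrix_mult_def transpose_def)
    also have "\<dots> = (\<Sum>a\<in>UNIV. if l = a then m p k * x $ k $ a * m p l else 0)"
      unfolding D_left by (intro sum.cong) (auto simp: D_def)
    finally show ?thesis by simp
  qed
  have pp: "m p p \<noteq> 0" using c by (simp add: m_def)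
  have "K x = msmult (1 / m p p) (D ** x ** transpose D)" if "x \<in> sym_mats" for x
  proof -
    have "K x $ k $ l = 1 / m p p * (m p k * x $ k $ l * m p l)" for k l
    proof -
      have "m p p * K x $ k $ l = m p k * x $ k $ l * m p l"
        unfolding Km[OF that] using mm[of p k l] by algebra
      then show ?thesis using pp by (simp add: field_simps)
    qed
    then show ?thesis by (simp add: vec_eq_iff D_conj)
  qed
  then show ?thesis by (rule that)
qed

section \<open>Congruence form of the maps\<close>

text \<open>The images of the E_ii are multiples of squares of vectors \<open>w i\<close>; a
  congruence carrying these back to the unit vectors reduces to the diagonally normalised
  case.\<close>

lemma linear_det_preserver_form:
  fixes L :: "'a::field^'n^'n \<Rightarrow> 'a^'n^'n"
  assumes char: "(2::'a) \<noteq> 0"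
    and card: "infinite (UNIV::'a set) \<or> CARD('a) \<ge> CARD('n)^2 + 1"
    and L_add: "\<And>x y. x \<in> sym_mats \<Longrightarrow> y \<in> sym_mats \<Longrightarrow> L (x + y) = L x + L y"
    and L_scale: "\<And>c x. x \<in> sym_mats \<Longrightarrow> L (msmult c x) = msmult c (L x)"
    and L_rk: "\<And>v. rank_le1 (L (rank1_sq v))"
    and L_det: "\<And>x. x \<in> sym_mats \<Longrightarrow> det (L x) = det x"
  obtains \<beta> u where "\<And>x. x \<in> sym_mats \<Longrightarrow> L x = msmult \<beta> (u ** x ** transpose u)"
proof -
  let ?E = "\<lambda>i. rank1_sq (axis i 1) :: 'a^'n^'n"
  have "\<exists>c w. L (?E i) = msmult c (rank1_sq w)" for i
    by (metis rank_le1_obtain[OF L_rk])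
  then obtain c w where cw: "\<And>i. L (?E i) = msmult (c i) (rank1_sq (w i))" by metis
  define W :: "'a^'n^'n" where "W = (\<chi> a b. w b $ a)"
  define C :: "'a^'n^'n" where "C = (\<chi> i j. if i = j then c i else 0)"
  have L_sum: "sum ?E T \<in> sym_mats \<and> L (sum ?E T) = (\<Sum>i\<in>T. L (?E i))" if "finite T" for T
    using that L_scale[of 0 0] by (induction T) (auto simp: L_add)
  have "(mat 1 :: 'a^'n^'n) = (\<Sum>i\<in>UNIV. ?E i)"
  proof -
    have "(\<Sum>i\<in>UNIV. ?E i $ k $ l) = (\<Sum>i\<in>UNIV. if k = i then (if k = l then 1 else 0) else 0)" for k l
      by (intro sum.cong) (auto simp: axis_def)
    then show ?thesis by (simp add: vec_eq_iff mat_def del: rank1_sq_component)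
  qed
  then have "L (mat 1) = (\<Sum>i\<in>UNIV. msmult (c i) (rank1_sq (w i)))"
    using L_sum[of UNIV] by (simp add: cw)
  also have "\<dots> = W ** C ** transpose W"
  proof -
    have "(W ** C) $ k $ i = c i * w i $ k" for k i
      by (simp add: W_def C_def matrix_matrix_mult_def if_distrib[of "\<lambda>y. _ * y"] mult.commute cong: if_cong)
    then have "(W ** C ** transpose W) $ k $ l = (\<Sum>i\<in>UNIV. c i * w i $ k * w i $ l)" for k l
      unfolding matrix_matrix_mult_def[of "W ** C"] by (simp add: transpose_def W_def)
    then show ?thesis by (simp add: vec_eq_iff mult.assoc)
  qed
  \<comment> \<open>Since \<open>L (mat 1)\<close> has determinant 1, the \<open>w i\<close> form a
    basis and no \<open>c i\<close> vanishes.\<close>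
  finally have "det W * det C * det W = 1"
    using L_det[of "mat 1"] by (simp add: det_mul)
  then have detW: "det W \<noteq> 0" and detC: "det C \<noteq> 0" by auto
  have c: "c i \<noteq> 0" for i
    using detC det_diagonal[of C] by (auto simp: C_def)
  from detW obtain V where V: "V ** W = mat 1" "W ** V = mat 1"
    unfolding invertible_det_nz[symmetric] invertible_def by blast
  define K where "K x = V ** L x ** transpose V" for x
  have LK: "L x = W ** K x ** transpose W" for x
  proof -
    have "W ** K x ** transpose W = (W ** V) ** L x ** transpose (W ** V)"
      by (simp add: K_def matrix_transpose_mul matrix_mul_assoc)
    then show ?thesis by (simp add: V transpose_mat)
  qed
  have K_add: "K (x + y) = K x + K y" if "x \<in> sym_mats" "y \<in> sym_mats" for x y
    using that by (simp add: K_def L_add matrix_add_ldistrib matrix_mult_add_rdistrib)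
  have K_scale: "K (msmult a x) = msmult a (K x)" if "x \<in> sym_mats" for x a
    using that by (simp add: K_def L_scale msmult_matrix_mult)
  have K_rk: "rank_le1 (K (rank1_sq v))" for v
  proof -
    obtain d z where "L (rank1_sq v) = msmult d (rank1_sq z)" using rank_le1_obtain[OF L_rk] .
    then have "K (rank1_sq v) = msmult d (rank1_sq (V *v z))"
      by (simp add: K_def msmult_matrix_mult conj_rank1_sq)
    then show ?thesis by (simp add: rank_le1_def mult_ac)
  qed
  have K_diag: "K (?E i) = msmult (c i) (?E i)" for i
  proof -
    have "w i = W *v axis i 1"
      by (simp add: vec_eq_iff W_def matrix_vector_mult_def axis_def if_distrib[of "\<lambda>y. _ * y"] cong: if_cong)
    then have "V *v w i = axis i 1" by (simp add: matrix_vector_mul_assoc V)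
    then show ?thesis by (simp add: K_def cw msmult_matrix_mult conj_rank1_sq)
  qed
  obtain \<beta> D where D: "\<And>x. x \<in> sym_mats \<Longrightarrow> K x = msmult \<beta> (D ** x ** transpose D)"
    using det_preserver_diag_normalized[OF char card K_add K_scale K_rk K_diag c] by blast
  have "L x = msmult \<beta> ((W ** D) ** x ** transpose (W ** D))" if "x \<in> sym_mats" for x
    by (simp add: LK[of x] D[OF that] msmult_matrix_mult matrix_transpose_mul matrix_mul_assoc)
  then show ?thesis by (rule that)
qed

lemma det_preserving_pair_form:
  fixes \<phi> \<psi> :: "'a::field^'n^'n \<Rightarrow> 'a^'n^'n"
  assumes char: "(2::'a) \<noteq> 0"
    and card: "infinite (UNIV::'a set) \<or> CARD('a) \<ge> CARD('n)^2 + 1"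
    and phi_into: "\<phi> ` sym_mats \<subseteq> sym_mats"
    and psi_surj: "\<psi> ` sym_mats = sym_mats"
    and det_pres: "\<And>x y. x \<in> sym_mats \<Longrightarrow> y \<in> sym_mats \<Longrightarrow> det (\<phi> x + \<psi> y) = det (x + y)"
  shows "\<exists>x0 u \<beta>. x0 \<in> sym_mats \<and> det (msmult \<beta> (u ** u)) = 1 \<and>
           (\<forall>x\<in>sym_mats. \<phi> x = msmult \<beta> (u ** (x + x0) ** transpose u) \<and>
                          \<psi> x = msmult \<beta> (u ** (x - x0) ** transpose u))"
proof -
  have phi: "\<phi> x \<in> sym_mats" if "x \<in> sym_mats" for x using phi_into that by blast
  obtain L where L: "\<And>x. x \<in> sym_mats \<Longrightarrow> \<phi> x = L x + \<phi> 0"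
    "\<And>x y. x \<in> sym_mats \<Longrightarrow> y \<in> sym_mats \<Longrightarrow> L (x + y) = L x + L y"
    "\<And>c x. x \<in> sym_mats \<Longrightarrow> L (msmult c x) = msmult c (L x)"
    "\<And>v. rank_le1 (L (rank1_sq v))"
    "\<And>x. x \<in> sym_mats \<Longrightarrow> det (L x) = det x"
    using det_preserving_pair_linear[where \<phi> = \<phi> and \<psi> = \<psi>, OF char phi psi_surj det_pres]
    by (metis (no_types, lifting))
  obtain \<beta> u where Lu: "\<And>x. x \<in> sym_mats \<Longrightarrow> L x = msmult \<beta> (u ** x ** transpose u)"
    using linear_det_preserver_form[OF char card L(2-5)] by blast
  \<comment> \<open>As \<open>u\<close> and its transpose have equal determinants, the value at the
    identity also normalises \<open>u ** u\<close>.\<close>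
  have "det (msmult \<beta> (u ** transpose u)) = 1"
    using L(5)[of "mat 1"] Lu[of "mat 1"] by simp
  then have det1: "\<beta> ^ CARD('n) * (det u * det u) = 1"
    by (simp add: det_msmult det_mul)
  then have "det u \<noteq> 0" and "\<beta> \<noteq> 0" by (auto simp: power_0_left)
  then obtain v where v: "v ** u = mat 1" "u ** v = mat 1"
    unfolding invertible_det_nz[symmetric] invertible_def by blast
  have conj_sym: "a ** y ** transpose a \<in> sym_mats" if "y \<in> sym_mats" for a y :: "'a^'n^'n"
    using that by (simp add: sym_mats_def matrix_transpose_mul matrix_mul_assoc)
  have L_surj: "\<exists>x\<in>sym_mats. L x = y" if "y \<in> sym_mats" for y
  proof
    let ?x = "msmult (1 / \<beta>) (v ** y ** transpose v)"
    show x: "?x \<in> sym_mats" by (simp add: conj_sym that)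
    have "u ** (v ** y ** transpose v) ** transpose u = (u ** v) ** y ** transpose (u ** v)"
      by (simp add: matrix_transpose_mul matrix_mul_assoc)
    then show "L ?x = y" using \<open>\<beta> \<noteq> 0\<close>
      by (simp add: Lu[OF x] msmult_matrix_mult v transpose_mat)
  qed
  \<comment> \<open>A preimage of \<open>\<phi> 0\<close> under \<open>L\<close> turns the additive
    constant into a shift of the argument.\<close>
  obtain x0 where x0: "x0 \<in> sym_mats" "L x0 = \<phi> 0" using L_surj phi[of 0] by auto
  have phi_eq: "\<phi> x = L (x + x0)" if "x \<in> sym_mats" for x
    using L(1)[OF that] L(2)[OF that x0(1)] x0(2) by simp
  \<comment> \<open>Each symmetric \<open>Y\<close> is \<open>L z = \<phi> (z - x0)\<close>, so
    \<open>det_pres\<close> compares \<open>\<psi> y\<close> with \<open>L (y - x0)\<close> at every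
    shift.\<close>
  have psi_eq: "\<psi> y = L (y - x0)" if y: "y \<in> sym_mats" for y
  proof (rule sym_mats_eqI_det[OF char])
    show "\<psi> y \<in> sym_mats" using imageI[OF y, of \<psi>] by (simp only: psi_surj)
    show "L (y - x0) \<in> sym_mats" using y x0 by (simp add: Lu conj_sym)
    fix Y :: "'a^'n^'n" assume Y: "Y \<in> sym_mats"
    then obtain z where z: "z \<in> sym_mats" "L z = Y" using L_surj by blast
    have "det (\<psi> y + Y) = det (\<phi> (z - x0) + \<psi> y)"
      using phi_eq[of "z - x0"] z x0 by (simp add: add.commute)
    also have "\<dots> = det (z - x0 + y)" using det_pres z x0 y by simp
    also have "\<dots> = det (L ((y - x0) + z))" using L(5)[of "(y - x0) + z"] z x0 y by (simp add: algebra_simps)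
    also have "\<dots> = det (L (y - x0) + Y)" using L(2)[of "y - x0" z] z x0 y by simp
    finally show "det (\<psi> y + Y) = det (L (y - x0) + Y)" .
  qed
  have "det (msmult \<beta> (u ** u)) = 1" using det1 by (simp only: det_msmult det_mul)
  moreover have "\<forall>x\<in>sym_mats. \<phi> x = msmult \<beta> (u ** (x + x0) ** transpose u)
      \<and> \<psi> x = msmult \<beta> (u ** (x - x0) ** transpose u)"
  proof
    fix x :: "'a^'n^'n" assume x: "x \<in> sym_mats"
    show "\<phi> x = msmult \<beta> (u ** (x + x0) ** transpose u)
      \<and> \<psi> x = msmult \<beta> (u ** (x - x0) ** transpose u)"
      using Lu[of "x + x0"] Lu[of "x - x0"] x x0(1) by (simp only: phi_eq psi_eq sym_mats_closed)
  qed
  ultimately show ?thesis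
    using x0(1) by - (rule exI[of _ x0], rule exI[of _ u], rule exI[of _ \<beta>], intro conjI)
qed

theorem theorem1p1:
  fixes \<phi> \<psi> :: "'a::field^'n^'n \<Rightarrow> 'a^'n^'n"
  assumes char: "(2::'a) \<noteq> 0"
    and card: "infinite (UNIV::'a set) \<or> CARD('a) \<ge> CARD('n)^2 + 1"
    and phi_into: "\<phi> ` sym_mats \<subseteq> sym_mats"
    and psi_into: "\<psi> ` sym_mats \<subseteq> sym_mats"
    and surj: "\<phi> ` sym_mats = sym_mats \<or> \<psi> ` sym_mats = sym_mats"
    and det_pres: "\<And>x y. x \<in> sym_mats \<Longrightarrow> y \<in> sym_mats \<Longrightarrow>
                    det (\<phi> x + \<psi> y) = det (x + y)"
  shows "\<exists>x0 u \<beta>. x0 \<in> sym_mats \<and> det (msmult \<beta> (u ** u)) = 1 \<and>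
           (\<forall>x\<in>sym_mats. \<phi> x = msmult \<beta> (u ** (x + x0) ** transpose u) \<and>
                          \<psi> x = msmult \<beta> (u ** (x - x0) ** transpose u))"
  using surj
proof
  assume psi_surj: "\<psi> ` sym_mats = sym_mats"
  show ?thesis
    by (rule det_preserving_pair_form[OF char card phi_into psi_surj]) (rule det_pres)
next
  assume phi_surj: "\<phi> ` sym_mats = sym_mats"
  \<comment> \<open>The hypothesis is symmetric in the two maps; exchanging them changes the sign of
    \<open>x0\<close>.\<close>
  have swap: "det (\<psi> x + \<phi> y) = det (x + y)" if "x \<in> sym_mats" "y \<in> sym_mats" for x y
    using det_pres[OF that(2,1)] by (simp only: add.commute)
  have "\<exists>x0 u \<beta>. x0 \<in> sym_mats \<and> det (msmult \<beta> (u ** u)) = 1 \<and>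
           (\<forall>x\<in>sym_mats. \<psi> x = msmult \<beta> (u ** (x + x0) ** transpose u) \<and>
                          \<phi> x = msmult \<beta> (u ** (x - x0) ** transpose u))"
    by (rule det_preserving_pair_form[OF char card psi_into phi_surj]) (rule swap)
  then obtain x0 u \<beta> where x0: "x0 \<in> sym_mats" and det1: "det (msmult \<beta> (u ** u)) = 1"
    and form: "\<forall>x\<in>sym_mats. \<psi> x = msmult \<beta> (u ** (x + x0) ** transpose u) \<and>
                          \<phi> x = msmult \<beta> (u ** (x - x0) ** transpose u)"
    by (elim exE conjE)
  have "\<forall>x\<in>sym_mats. \<phi> x = msmult \<beta> (u ** (x + - x0) ** transpose u) \<and>
                          \<psi> x = msmult \<beta> (u ** (x - - x0) ** transpose u)"
    using form by (simp only: add_uminus_conv_diff diff_minus_eq_add conj_commute)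
  then show ?thesis
    using sym_mats_closed(6)[OF x0] det1
    by - (rule exI[of _ "- x0"], rule exI[of _ u], rule exI[of _ \<beta>], intro conjI)
qed

end
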